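(* Let $f_1,f_2$ be functions given by Dirichlet series $f_i(s)=\sum_{n\ge1}a_i(n)n^{-s}$ convergent in some half planes, and let $\sum_{n\ge1}b_i(n)n^{-s}$ ($i=1,2$) be Dirichlet series convergent in some half planes. Let $\psi_1(s),\psi_2(s)$ be given functions and let $\delta$ be a fixed complex number. Suppose that in a certain region of the complex plane $f_1$ and $f_2$ satisfy the relations $$f_1(s)=\sum_{n\le x_1}a_1(n)n^{-s}+\psi_1(s)\sum_{n\le y_1}b_1(n)n^{s-\delta}+E_1(s,x_1),$$ $$f_2(s)=\sum_{n\le x_2}a_2(n)n^{-s}+\psi_2(s)\sum_{n\le y_2}b_2(n)n^{s-\delta}+E_2(s,x_2),$$ with $x_1,x_2>0$, $y_1=T_1/x_1$, $y_2=T_2/x_2$, so that $y_1,y_2\ge0$. Then in the same region $$f_1(s)f_2(s)=\sum_{n\le x_1x_2}A(n)n^{-s}+\psi_1(s)\psi_2(s)\sum_{n\le y_1y_2}B(n)n^{s-\delta}+E_{1,2}(s,x_1x_2),$$ where $A(n)=\sum_{uv=n}a_1(u)a_2(v)$, $B(n)=\sum_{uv=n}b_1(u)b_2(v)$ and $$E_{1,2}(s,x_1x_2)=I_1+I_2+I_3+I_4+I_5+L_1+L_2$$ with $$I_1=\sum_{n\le x_1}a_1(n)n^{-s}E_2\Big(s,\frac{x_1x_2}{n}\Big),\qquad I_2=\sum_{n\le x_2}a_2(n)n^{-s}E_1\Big(s,\frac{x_1x_2}{n}\Big),$$ $$I_3=\psi_1(s)\sum_{m\le y_1}b_1(m)m^{s-\delta}E_2\Big(s,\frac{mx_2}{y_1}\Big),\qquad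 I_4=\psi_2(s)\sum_{m\le y_2}b_2(m)m^{s-\delta}E_1\Big(s,\frac{mx_1}{y_2}\Big),$$ $$I_5=E_1(s,x_1)E_2(s,x_2),$$ $$L_1=\psi_1(s)\,\ell_2^{-s}\sum_{m\le y_1}b_1(m)\,a_2(\ell_2m)\,m^{-\delta},\qquad L_2=\psi_2(s)\,\ell_1^{-s}\sum_{n\le y_2}b_2(n)\,a_1(\ell_1n)\,n^{-\delta},$$ where $\ell_1=x_1/y_2$, $\ell_2=x_2/y_1$, and $a_1(\ell_1n)=0$ if $\ell_1n$ is not an integer, $a_2(\ell_2m)=0$ if $\ell_2m$ is not an integer. In addition, if there are functional equations $f_1(s)=\psi_1(s)f_1(\delta-s)$ and $f_2(s)=\psi_2(s)f_2(\delta-s)$, then $$I_3=\psi_1(s)\psi_2(s)\sum_{n\le y_1}b_1(n)n^{s-\delta}E_2\Big(\delta-s,\frac{y_1y_2}{n}\Big),\qquad I_4=\psi_1(s)\psi_2(s)\sum_{n\le y_2}b_2(n)n^{s-\delta}E_1\Big(\delta-s,\frac{y_1y_2}{n}\Big).$$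
   Context: All sums run over positive integers. The displayed relation for $f_i$, taken for every real $x_i>0$, defines the remainder $E_i(s,x)$; $E_i(\delta-s,x)$ is the remainder in the same relation at the point $\delta-s$. The quantities $T_1,T_2\ge0$ depend only on $s$ (and possibly some other parameters), $T_1$ being independent of $x_1$ and $T_2$ independent of $x_2$. Empty sums are zero; in particular if $y_1<1$ or $y_2<1$ (including the value $0$), the corresponding sums over $n\le y_1$ or $n\le y_2$ are zero. $E_{1,2}(s,x_1x_2)$ is the name of the remainder term for the given $x_1,x_2$.
   Formalization: In the "in addition" part, assumed also: b_i=a_i, T_i(δ−s)=T_i(s), δ−s in the region, region open, f_i analytically continued to it, ψ_i continuous there; the I_3 formula needs y_1<1 or y_2>0, the I_4 formula y_2<1 or y_1>0. Otherwise it can fail or be undefined. *)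

theory Defs
  imports "HOL-Complex_Analysis.Complex_Analysis"
begin

text \<open>
  Coefficient sequences are functions on \<^typ>\<open>nat\<close> of which only the values at positive
  arguments are ever used.
\<close>

definition dirichlet_series_sums :: "(nat \<Rightarrow> complex) \<Rightarrow> complex \<Rightarrow> complex \<Rightarrow> bool" where
  "dirichlet_series_sums a s z \<longleftrightarrow> (\<lambda>n. a (Suc n) * of_nat (Suc n) powr (-s)) sums z"

definition given_by_dirichlet_series :: "(complex \<Rightarrow> complex) \<Rightarrow> (nat \<Rightarrow> complex) \<Rightarrow> bool" where
  "given_by_dirichlet_series f a \<longleftrightarrow>
     (\<exists>c::real. \<forall>s. Re s > c \<longrightarrow> dirichlet_series_sums a s (f s))"

definition dirichlet_series_converges :: "(nat \<Rightarrow> complex) \<Rightarrow> bool" where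
  "dirichlet_series_converges b \<longleftrightarrow>
     (\<exists>c::real. \<forall>s. Re s > c \<longrightarrow> (\<exists>z. dirichlet_series_sums b s z))"

text \<open>The finite sum of \<open>c(n) n\<^sup>w\<close> over positive integers \<open>n \<le> x\<close>; it is empty for \<open>x < 1\<close>.\<close>

definition psum :: "(nat \<Rightarrow> complex) \<Rightarrow> complex \<Rightarrow> real \<Rightarrow> complex" where
  "psum c w x = (\<Sum>n | 0 < n \<and> real n \<le> x. c n * of_nat n powr w)"

text \<open>For \<open>n = 0\<close> the index set is infinite; that value is never used.\<close>

definition dconv :: "(nat \<Rightarrow> complex) \<Rightarrow> (nat \<Rightarrow> complex) \<Rightarrow> nat \<Rightarrow> complex" where
  "dconv a b n = (\<Sum>(u, v) | u * v = n. a u * b v)"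

text \<open>A coefficient at a real argument \<open>r \<ge> 0\<close>, zero unless \<open>r\<close> is an integer.\<close>

definition coeff_at :: "(nat \<Rightarrow> complex) \<Rightarrow> real \<Rightarrow> complex" where
  "coeff_at a r = (if r \<in> \<int> then a (nat \<lfloor>r\<rfloor>) else 0)"

text \<open>
  The values of \<open>f\<close> on \<open>R\<close> and those in a half plane of large real part belong to one
  holomorphic function on a connected open set (which may omit poles of \<open>f\<close>).
\<close>

definition continued_analytically_to :: "(complex \<Rightarrow> complex) \<Rightarrow> complex set \<Rightarrow> bool" where
  "continued_analytically_to f R \<longleftrightarrow>
     (\<exists>D c. open D \<and> connected D \<and> {s. Re s > c} \<subseteq> D \<and> R \<subseteq> D \<and> f holomorphic_on D)"

text \<open>
  What a functional equation \<open>f(s) = \<psi>(s) f(\<delta> - s)\<close> carries with it besides the equation itself.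
  The dual coefficients \<open>b\<close> are those of \<open>f\<close>, because the function on the right-hand side is \<open>f\<close>
  again; \<open>T\<close> is invariant under \<open>s \<mapsto> \<delta> - s\<close>, so that the relation at \<open>\<delta> - s\<close> has the lengths \<open>x\<close>
  and \<open>y\<close> interchanged; and the equation is one between analytic functions on an open set (only
  continuity of \<open>\<psi>\<close> is needed).  The identity \<open>\<psi>(s) \<psi>(\<delta> - s) = 1\<close> is not part of this: it follows
  from the functional equation where \<open>f(s) \<noteq> 0\<close>, and by continuity at the zeros of \<open>f\<close>.
\<close>

definition self_dual_on ::
    "complex set \<Rightarrow> complex \<Rightarrow> (complex \<Rightarrow> complex) \<Rightarrow> (nat \<Rightarrow> complex) \<Rightarrow> (nat \<Rightarrow> complex) \<Rightarrow>
     (complex \<Rightarrow> complex) \<Rightarrow> (complex \<Rightarrow> real) \<Rightarrow> bool" where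
  "self_dual_on R \<delta> f a b \<psi> T \<longleftrightarrow>
     (\<forall>n>0. b n = a n) \<and>
     (\<forall>s\<in>R. \<delta> - s \<in> R \<longrightarrow> T (\<delta> - s) = T s) \<and>
     open R \<and> continued_analytically_to f R \<and> continuous_on R \<psi>"

end

theory Submission
  imports Defs
begin

text \<open>
  Expand \<open>(f\<^sub>1 - S\<^sub>1 - D\<^sub>1) (f\<^sub>2 - S\<^sub>2 - D\<^sub>2) = E\<^sub>1 E\<^sub>2\<close>, where \<open>S\<^sub>i\<close> is the sum over \<open>a\<^sub>i\<close> and
  \<open>D\<^sub>i\<close> is \<open>\<psi>\<^sub>i(s)\<close> times the sum over \<open>b\<^sub>i\<close>.  Inserting the given relations for the inner
  remainders writes \<open>I\<^sub>1, \<dots>, I\<^sub>4\<close> as double sums.  Those over \<open>a\<^sub>1 a\<^sub>2\<close> and over \<open>b\<^sub>1 b\<^sub>2\<close>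
  recombine by Dirichlet's hyperbola method; the mixed ones tile a rectangle whose diagonal is
  counted twice and gives \<open>L\<^sub>1\<close> and \<open>L\<^sub>2\<close>.  Under the functional equations
  \<open>\<psi>(s) \<psi>(\<delta> - s) = 1\<close>, since the zeros of \<open>f\<close> are isolated, unless \<open>f\<close> vanishes identically;
  in that case its coefficients vanish by uniqueness of Dirichlet series.  Either way
  \<open>E(s, x) = \<psi>(s) E(\<delta> - s, T / x)\<close>.
\<close>

section \<open>Lattice-point sums: the hyperbola region, and a rectangle cut by its diagonal\<close>

abbreviation (input) nats_upto :: "real \<Rightarrow> nat set" where
  "nats_upto x \<equiv> {n. 0 < n \<and> real n \<le> x}"

abbreviation (input) pairs_upto :: "real \<Rightarrow> (nat \<times> nat) set" where
  "pairs_upto x \<equiv> {(u, v). 0 < u \<and> 0 < v \<and> real (u * v) \<le> x}"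

lemma finite_nats_upto [simp]: "finite (nats_upto x)"
proof (rule finite_subset)
  show "nats_upto x \<subseteq> {..nat \<lfloor>x\<rfloor>}" by (auto simp: le_nat_floor)
qed simp

lemma nats_upto_empty: "x < 1 \<Longrightarrow> nats_upto x = {}"
  by auto

lemma finite_pairs_upto: "finite (pairs_upto x)"
proof (rule finite_subset)
  show "pairs_upto x \<subseteq> nats_upto x \<times> nats_upto x"
  proof
    fix p assume "p \<in> pairs_upto x"
    then obtain u v where p: "p = (u, v)" and uv: "0 < u" "0 < v" "real (u * v) \<le> x" by blast
    have "u \<le> u * v" "v \<le> u * v" using uv by auto
    then have "real u \<le> real (u * v)" "real v \<le> real (u * v)" by (simp_all only: of_nat_le_iff)
    then have "real u \<le> x" "real v \<le> x" using uv by linarith+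
    with p uv show "p \<in> nats_upto x \<times> nats_upto x" by simp
  qed
qed simp

text \<open>Dirichlet's hyperbola method. The two double sums run over the points under the
  hyperbola \<open>u * v = X * Y\<close> with \<open>u \<le> X\<close>, respectively with
  \<open>v \<le> Y\<close>. Together they cover the whole region, since \<open>u > X\<close> and
  \<open>v > Y\<close> would give too large a product, and they overlap exactly in the rectangle.
  Inclusion-exclusion finishes.\<close>

lemma sum_hyperbola:
  fixes g h :: "nat \<Rightarrow> complex"
  assumes "X \<ge> 0" "Y \<ge> 0"
  shows "(\<Sum>u\<in>nats_upto X. g u * sum h (nats_upto (X * Y / real u)))
       + (\<Sum>v\<in>nats_upto Y. h v * sum g (nats_upto (X * Y / real v)))
       = (\<Sum>(u, v)\<in>pairs_upto (X * Y). g u * h v) + sum g (nats_upto X) * sum h (nats_upto Y)"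
proof -
  let ?F = "\<lambda>(u, v). g u * h v"
  define A where "A = Sigma (nats_upto X) (\<lambda>u. nats_upto (X * Y / real u))"
  define B where "B = prod.swap ` Sigma (nats_upto Y) (\<lambda>v. nats_upto (X * Y / real v))"
  have fin: "finite A" "finite B" by (auto simp: A_def B_def)
  have A: "(\<Sum>u\<in>nats_upto X. g u * sum h (nats_upto (X * Y / real u))) = sum ?F A"
    by (simp add: A_def sum.Sigma sum_distrib_left)
  have "sum ?F B = (\<Sum>(v, u)\<in>Sigma (nats_upto Y) (\<lambda>v. nats_upto (X * Y / real v)). g u * h v)"
    unfolding B_def by (subst sum.reindex) (auto simp: case_prod_unfold)
  then have B: "(\<Sum>v\<in>nats_upto Y. h v * sum g (nats_upto (X * Y / real v))) = sum ?F B"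
    by (simp add: sum.Sigma sum_distrib_left mult.commute)
  have un: "A \<union> B = pairs_upto (X * Y)"
  proof -
    have "real u \<le> X \<or> real v \<le> Y" if "real u * real v \<le> X * Y" for u v :: nat
    proof (rule ccontr)
      assume "\<not> ?thesis"
      then have "X * Y < real u * real v" using assms by (intro mult_strict_mono') auto
      with that show False by simp
    qed
    then show ?thesis by (fastforce simp: A_def B_def image_iff field_simps)
  qed
  have int: "A \<inter> B = nats_upto X \<times> nats_upto Y"
  proof -
    have "real u * real v \<le> X * Y" if "real u \<le> X" "real v \<le> Y" for u v :: nat
      using that assms by (intro mult_mono) auto
    then show ?thesis by (fastforce simp: A_def B_def image_iff field_simps)
  qed
  show ?thesis
    unfolding A B sum.union_inter[OF fin, symmetric] un int
    by (simp add: sum_product sum.cartesian_product)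
qed

lemma coeff_at_of_nat: "coeff_at h (real n) = h n"
  by (simp add: coeff_at_def)

text \<open>The index set has at most one element. In this form the diagonal coefficients can be
  summed as a set of lattice points; the bounds on \<open>r\<close> put the integer in
  range.\<close>

lemma coeff_at_eq_sum:
  assumes "r > 0" "r \<le> X"
  shows "coeff_at h r = (\<Sum>n | n \<in> nats_upto X \<and> real n = r. h n)"
proof (cases "r \<in> \<int>")
  case True
  then obtain k :: int where k: "r = of_int k" by (elim Ints_cases)
  then have r: "r = real (nat k)" using assms by simp
  have "{n. n \<in> nats_upto X \<and> real n = r} = {nat k}" using assms r by auto
  then show ?thesis using r by (simp add: coeff_at_of_nat)
next
  case False
  then have "{n. n \<in> nats_upto X \<and> real n = r} = {}" by auto
  then show ?thesis using False by (simp only: coeff_at_def if_False sum.empty)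
qed

text \<open>The line \<open>n * Y = m * X\<close> is the diagonal of the rectangle
  \<open>m \<le> Y\<close>, \<open>n \<le> X\<close>. The two double sums run over the two closed
  triangles it cuts off, so the lattice points on the diagonal are counted twice; there
  \<open>n = X / Y * m\<close>.\<close>

lemma sum_rectangle_diagonal:
  fixes g h :: "nat \<Rightarrow> complex"
  assumes "X > 0" "Y \<ge> 0"
  shows "(\<Sum>n\<in>nats_upto X. h n * sum g (nats_upto (real n * Y / X)))
       + (\<Sum>m\<in>nats_upto Y. g m * sum h (nats_upto (real m * X / Y)))
       = sum g (nats_upto Y) * sum h (nats_upto X)
         + (\<Sum>m\<in>nats_upto Y. g m * coeff_at h (X / Y * real m))"
proof (cases "Y = 0")
  case True
  \<comment> \<open>For a degenerate rectangle every sum has an empty range, so the value of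
    \<open>X / 0\<close> does not matter.\<close>
  then have "nats_upto Y = {}" "\<And>n. nats_upto (real n * Y / X) = {}" by auto
  then show ?thesis by (simp only: sum.empty) simp
next
  case False
  with assms have Y: "Y > 0" by simp
  let ?F = "\<lambda>(m, n). g m * h n"
  define A where "A = prod.swap ` Sigma (nats_upto X) (\<lambda>n. nats_upto (real n * Y / X))"
  define B where "B = Sigma (nats_upto Y) (\<lambda>m. nats_upto (real m * X / Y))"
  define D where "D = Sigma (nats_upto Y) (\<lambda>m. {n. n \<in> nats_upto X \<and> real n = X / Y * real m})"
  have fin: "finite A" "finite B" by (auto simp: A_def B_def)
  have "sum ?F A = (\<Sum>(n, m)\<in>Sigma (nats_upto X) (\<lambda>n. nats_upto (real n * Y / X)). g m * h n)"
    unfolding A_def by (subst sum.reindex) (auto simp: case_prod_unfold)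
  then have A: "(\<Sum>n\<in>nats_upto X. h n * sum g (nats_upto (real n * Y / X))) = sum ?F A"
    by (simp add: sum.Sigma sum_distrib_left mult.commute)
  have B: "(\<Sum>m\<in>nats_upto Y. g m * sum h (nats_upto (real m * X / Y))) = sum ?F B"
    by (simp add: B_def sum.Sigma sum_distrib_left)
  have A_iff: "(m, n) \<in> A \<longleftrightarrow> 0 < m \<and> 0 < n \<and> real n \<le> X \<and> real m * X \<le> real n * Y" for m n
    using assms Y by (auto simp: A_def image_iff field_simps)
  have B_iff: "(m, n) \<in> B \<longleftrightarrow> 0 < m \<and> 0 < n \<and> real m \<le> Y \<and> real n * Y \<le> real m * X" for m n
    using assms Y by (auto simp: B_def field_simps)
  have D_iff: "(m, n) \<in> D \<longleftrightarrow> 0 < m \<and> 0 < n \<and> real m \<le> Y \<and> real n \<le> X \<and> real n * Y = real m * X"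
    for m n using assms Y by (auto simp: D_def field_simps)
  \<comment> \<open>Each double sum bounds only one coordinate explicitly; the slope condition
    bounds the other.\<close>
  have le_Y: "real m \<le> Y" if "real n \<le> X" "real m * X \<le> real n * Y" for m n
  proof -
    have "real n * Y \<le> X * Y" using that Y by (intro mult_right_mono) auto
    then have "real m * X \<le> Y * X" using that by (simp add: mult.commute)
    then show ?thesis using assms by simp
  qed
  have le_X: "real n \<le> X" if "real m \<le> Y" "real n * Y \<le> real m * X" for m n
  proof -
    have "real m * X \<le> Y * X" using that assms by (intro mult_right_mono) auto
    then have "real n * Y \<le> X * Y" using that by (simp add: mult.commute)
    then show ?thesis using Y by simp
  qed
  have un: "A \<union> B = nats_upto Y \<times> nats_upto X"
  proof (rule set_eqI, clarify)
    fix m n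
    show "(m, n) \<in> A \<union> B \<longleftrightarrow> (m, n) \<in> nats_upto Y \<times> nats_upto X"
      using le_X[of m n] le_Y[of n m] by (auto simp: A_iff B_iff)
  qed
  have int: "A \<inter> B = D"
  proof (rule set_eqI, clarify)
    fix m n
    show "(m, n) \<in> A \<inter> B \<longleftrightarrow> (m, n) \<in> D" by (auto simp: A_iff B_iff D_iff)
  qed
  have D: "sum ?F D = (\<Sum>m\<in>nats_upto Y. g m * coeff_at h (X / Y * real m))"
  proof -
    have "sum ?F D = (\<Sum>m\<in>nats_upto Y. \<Sum>n | n \<in> nats_upto X \<and> real n = X / Y * real m. g m * h n)"
      unfolding D_def
      by (subst sum.Sigma) (auto intro: finite_subset[OF _ finite_nats_upto[of X]])
    also have "\<dots> = (\<Sum>m\<in>nats_upto Y. g m * coeff_at h (X / Y * real m))"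
    proof (rule sum.cong[OF refl])
      fix m assume m: "m \<in> nats_upto Y"
      then have "X / Y * real m > 0" "X / Y * real m \<le> X"
        using assms Y by (auto simp: field_simps)
      from coeff_at_eq_sum[OF this, of h]
      show "(\<Sum>n | n \<in> nats_upto X \<and> real n = X / Y * real m. g m * h n)
          = g m * coeff_at h (X / Y * real m)"
        by (simp add: sum_distrib_left)
    qed
    finally show ?thesis .
  qed
  show ?thesis
    unfolding A B sum.union_inter[OF fin, symmetric] un int D
    by (simp add: sum_product sum.cartesian_product)
qed

section \<open>The product identity at a fixed point\<close>

lemma sum_mult_remainder:
  fixes g P Q e :: "'a \<Rightarrow> complex"
  assumes "\<And>n. n \<in> U \<Longrightarrow> F = P n + p * Q n + e n"
  shows "(\<Sum>n\<in>U. g n * e n)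
       = F * sum g U - (\<Sum>n\<in>U. g n * P n) - p * (\<Sum>n\<in>U. g n * Q n)"
proof -
  have "(\<Sum>n\<in>U. g n * e n) = (\<Sum>n\<in>U. F * g n - g n * P n - p * (g n * Q n))"
  proof (rule sum.cong[OF refl])
    fix n assume "n \<in> U"
    from assms[OF this] have F: "F = P n + p * Q n + e n" .
    show "g n * e n = F * g n - g n * P n - p * (g n * Q n)" unfolding F by (simp add: algebra_simps)
  qed
  then show ?thesis by (simp add: sum_subtractf sum_distrib_left)
qed

text \<open>With \<open>s\<close> fixed, the powers of \<open>n\<close> are absorbed into the
  coefficients \<alpha> and \<beta>, so only finite sums and algebra remain. Each inner remainder is
  eliminated by the relation at its own argument.\<close>

lemma approximate_product:
  fixes \<alpha>1 \<alpha>2 \<beta>1 \<beta>2 :: "nat \<Rightarrow> complex" and e1 e2 :: "real \<Rightarrow> complex"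
  assumes rel1: "\<And>x. x > 0 \<Longrightarrow> F1 = sum \<alpha>1 (nats_upto x) + p1 * sum \<beta>1 (nats_upto (t1 / x)) + e1 x"
    and rel2: "\<And>x. x > 0 \<Longrightarrow> F2 = sum \<alpha>2 (nats_upto x) + p2 * sum \<beta>2 (nats_upto (t2 / x)) + e2 x"
    and x: "x1 > 0" "x2 > 0" and t: "t1 \<ge> 0" "t2 \<ge> 0"
    and y: "y1 = t1 / x1" "y2 = t2 / x2"
  shows "F1 * F2 =
      (\<Sum>(u, v)\<in>pairs_upto (x1 * x2). \<alpha>1 u * \<alpha>2 v)
    + p1 * p2 * (\<Sum>(u, v)\<in>pairs_upto (y1 * y2). \<beta>1 u * \<beta>2 v)
    + ((\<Sum>n\<in>nats_upto x1. \<alpha>1 n * e2 (x1 * x2 / real n))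
     + (\<Sum>n\<in>nats_upto x2. \<alpha>2 n * e1 (x1 * x2 / real n))
     + p1 * (\<Sum>m\<in>nats_upto y1. \<beta>1 m * e2 (real m * x2 / y1))
     + p2 * (\<Sum>m\<in>nats_upto y2. \<beta>2 m * e1 (real m * x1 / y2))
     + e1 x1 * e2 x2
     + p1 * (\<Sum>m\<in>nats_upto y1. \<beta>1 m * coeff_at \<alpha>2 (x2 / y1 * real m))
     + p2 * (\<Sum>m\<in>nats_upto y2. \<beta>2 m * coeff_at \<alpha>1 (x1 / y2 * real m)))"
proof -
  have y0: "y1 \<ge> 0" "y2 \<ge> 0" using x t y by auto
  have I1: "(\<Sum>n\<in>nats_upto x1. \<alpha>1 n * e2 (x1 * x2 / real n)) = F2 * sum \<alpha>1 (nats_upto x1)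
      - (\<Sum>n\<in>nats_upto x1. \<alpha>1 n * sum \<alpha>2 (nats_upto (x1 * x2 / real n)))
      - p2 * (\<Sum>n\<in>nats_upto x1. \<alpha>1 n * sum \<beta>2 (nats_upto (real n * y2 / x1)))"
  proof (rule sum_mult_remainder)
    fix n assume n: "n \<in> nats_upto x1"
    \<comment> \<open>The two lengths in a relation multiply to \<open>t2 = x2 * y2\<close>, which
      determines the dual length at the new argument.\<close>
    then have "t2 / (x1 * x2 / real n) = real n * y2 / x1" using x y by (simp add: field_simps)
    with rel2[of "x1 * x2 / real n"] n x
    show "F2 = sum \<alpha>2 (nats_upto (x1 * x2 / real n))
        + p2 * sum \<beta>2 (nats_upto (real n * y2 / x1)) + e2 (x1 * x2 / real n)" by simp
  qed
  have I2: "(\<Sum>n\<in>nats_upto x2. \<alpha>2 n * e1 (x1 * x2 / real n)) = F1 * sum \<alpha>2 (nats_upto x2)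
      - (\<Sum>n\<in>nats_upto x2. \<alpha>2 n * sum \<alpha>1 (nats_upto (x1 * x2 / real n)))
      - p1 * (\<Sum>n\<in>nats_upto x2. \<alpha>2 n * sum \<beta>1 (nats_upto (real n * y1 / x2)))"
  proof (rule sum_mult_remainder)
    fix n assume n: "n \<in> nats_upto x2"
    then have "t1 / (x1 * x2 / real n) = real n * y1 / x2" using x y by (simp add: field_simps)
    with rel1[of "x1 * x2 / real n"] n x
    show "F1 = sum \<alpha>1 (nats_upto (x1 * x2 / real n))
        + p1 * sum \<beta>1 (nats_upto (real n * y1 / x2)) + e1 (x1 * x2 / real n)" by simp
  qed
  have I3: "(\<Sum>m\<in>nats_upto y1. \<beta>1 m * e2 (real m * x2 / y1)) = F2 * sum \<beta>1 (nats_upto y1)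
      - (\<Sum>m\<in>nats_upto y1. \<beta>1 m * sum \<alpha>2 (nats_upto (real m * x2 / y1)))
      - p2 * (\<Sum>m\<in>nats_upto y1. \<beta>1 m * sum \<beta>2 (nats_upto (y1 * y2 / real m)))"
  proof (rule sum_mult_remainder)
    fix m assume m: "m \<in> nats_upto y1"
    \<comment> \<open>An index \<open>m \<le> y1\<close> exists only for positive \<open>y1\<close>,
      so the division by \<open>y1\<close> is genuine wherever a term occurs.\<close>
    then have y1: "y1 > 0" by auto
    then have "t2 / (real m * x2 / y1) = y1 * y2 / real m" using x y m by (simp add: field_simps)
    with rel2[of "real m * x2 / y1"] m x y1
    show "F2 = sum \<alpha>2 (nats_upto (real m * x2 / y1))
        + p2 * sum \<beta>2 (nats_upto (y1 * y2 / real m)) + e2 (real m * x2 / y1)" by simp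
  qed
  have I4: "(\<Sum>m\<in>nats_upto y2. \<beta>2 m * e1 (real m * x1 / y2)) = F1 * sum \<beta>2 (nats_upto y2)
      - (\<Sum>m\<in>nats_upto y2. \<beta>2 m * sum \<alpha>1 (nats_upto (real m * x1 / y2)))
      - p1 * (\<Sum>m\<in>nats_upto y2. \<beta>2 m * sum \<beta>1 (nats_upto (y1 * y2 / real m)))"
  proof (rule sum_mult_remainder)
    fix m assume m: "m \<in> nats_upto y2"
    then have y2: "y2 > 0" by auto
    then have "t1 / (real m * x1 / y2) = y1 * y2 / real m" using x y m by (simp add: field_simps)
    with rel1[of "real m * x1 / y2"] m x y2
    show "F1 = sum \<alpha>1 (nats_upto (real m * x1 / y2))
        + p1 * sum \<beta>1 (nats_upto (y1 * y2 / real m)) + e1 (real m * x1 / y2)" by simp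
  qed
  note hA = sum_hyperbola[of x1 x2 \<alpha>1 \<alpha>2] and hB = sum_hyperbola[OF y0, of \<beta>1 \<beta>2]
  note d1 = sum_rectangle_diagonal[of x2 y1 \<alpha>2 \<beta>1] and d2 = sum_rectangle_diagonal[of x1 y2 \<alpha>1 \<beta>2]
  have e1: "e1 x1 = F1 - sum \<alpha>1 (nats_upto x1) - p1 * sum \<beta>1 (nats_upto y1)"
    using rel1[OF x(1)] y by (simp add: algebra_simps)
  have e2: "e2 x2 = F2 - sum \<alpha>2 (nats_upto x2) - p2 * sum \<beta>2 (nats_upto y2)"
    using rel2[OF x(2)] y by (simp add: algebra_simps)
  \<comment> \<open>With the remainders gone, the claim is a polynomial identity modulo
    \<open>hA\<close>, \<open>hB\<close>, \<open>d1\<close> and \<open>d2\<close>. Here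
    \<open>H1\<close>, \<open>H2\<close>, \<open>M1\<close>, \<open>M2\<close> are the hyperbola
    sums, \<open>Q1\<close>, \<open>Q2\<close>, \<open>K1\<close>, \<open>K2\<close> the mixed
    double sums, and \<open>C1\<close>, \<open>C2\<close> the diagonals.\<close>
  have combine: "F1 * F2 = PA + p1 * p2 * PB + ((F2 * A1 - H1 - p2 * Q1) + (F1 * A2 - H2 - p1 * Q2)
      + p1 * (F2 * B1 - K1 - p2 * M1) + p2 * (F1 * B2 - K2 - p1 * M2)
      + (F1 - A1 - p1 * B1) * (F2 - A2 - p2 * B2) + p1 * C1 + p2 * C2)"
    if "H1 + H2 = PA + A1 * A2" "M1 + M2 = PB + B1 * B2"
      "Q2 + K1 = B1 * A2 + C1" "Q1 + K2 = B2 * A1 + C2"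
    for PA PB A1 A2 B1 B2 H1 H2 K1 K2 M1 M2 Q1 Q2 C1 C2 :: complex
  proof -
    have eqs: "PA = H1 + H2 - A1 * A2" "PB = M1 + M2 - B1 * B2"
      "C1 = Q2 + K1 - B1 * A2" "C2 = Q1 + K2 - B2 * A1"
      using that by (simp_all add: algebra_simps)
    show ?thesis unfolding eqs by (simp add: algebra_simps)
  qed
  show ?thesis
    unfolding I1 I2 I3 I4 e1 e2
    by (rule combine) (use hA hB d1 d2 x y0 in auto)
qed

section \<open>Passing from absorbed coefficients back to complex powers\<close>

lemma of_nat_powr_mult:
  "of_nat (u * v) powr (w::complex) = of_nat u powr w * of_nat v powr w"
  by (simp add: powr_times_real)

text \<open>Group the pairs by their product \<open>n\<close>. As \<open>n > 0\<close>, every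
  factorisation has positive factors, and the power splits over it.\<close>

lemma psum_dconv:
  "psum (dconv a b) w x
   = (\<Sum>(u, v)\<in>pairs_upto x. (a u * of_nat u powr w) * (b v * of_nat v powr w))"
proof -
  let ?F = "\<lambda>(u, v). (a u * of_nat u powr w) * (b v * of_nat v powr w)"
  have "psum (dconv a b) w x = (\<Sum>n\<in>nats_upto x. \<Sum>p | p \<in> pairs_upto x \<and> fst p * snd p = n. ?F p)"
    unfolding psum_def
  proof (rule sum.cong[OF refl])
    fix n assume n: "n \<in> nats_upto x"
    then have "{(u, v). u * v = n} = {p. p \<in> pairs_upto x \<and> fst p * snd p = n}" by auto
    then show "dconv a b n * of_nat n powr w
      = (\<Sum>p | p \<in> pairs_upto x \<and> fst p * snd p = n. ?F p)"
      unfolding dconv_def sum_distrib_right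
      by (intro sum.cong) (auto simp: of_nat_powr_mult simp del: of_nat_mult)
  qed
  also have "\<dots> = sum ?F (pairs_upto x)"
    by (rule sum.group[OF finite_pairs_upto finite_nats_upto]) auto
  finally show ?thesis .
qed

text \<open>If \<open>l * m\<close> is an integer, its power splits because both factors are
  positive reals; otherwise both sides vanish. The factor \<open>l powr (-s)\<close> is the one in
  front of \<open>L1\<close> and \<open>L2\<close>.\<close>

lemma coeff_at_powr:
  assumes "l > 0" "m > 0"
  shows "coeff_at (\<lambda>n. a n * of_nat n powr (-s)) (l * real m)
       = of_real l powr (-s) * (coeff_at a (l * real m) * of_nat m powr (-s))"
proof (cases "l * real m \<in> \<int>")
  case True
  then obtain k :: int where k: "l * real m = of_int k" by (elim Ints_cases)
  have "of_int k > (0::real)" unfolding k[symmetric] using assms by simp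
  then have n: "l * real m = real (nat k)" using k by simp
  have "of_nat (nat k) = (of_real l * of_nat m :: complex)"
    using arg_cong[OF n, of complex_of_real] by simp
  then have "of_nat (nat k) powr (-s) = of_real l powr (-s) * of_nat m powr (-s)"
    using assms by (simp add: powr_times_real)
  then show ?thesis unfolding n coeff_at_of_nat by simp
next
  case False
  then show ?thesis by (simp add: coeff_at_def)
qed

text \<open>Brings the diagonal terms into the shape of \<open>L1\<close> and \<open>L2\<close>: the
  powers with exponents \<open>s - \<delta>\<close> and \<open>-s\<close> combine to exponent
  \<open>-\<delta>\<close>.\<close>

lemma diagonal_sum_powr:
  assumes "x > 0" and l: "l = x / y"
  shows "p * (\<Sum>m\<in>nats_upto y. (b m * of_nat m powr (s - \<delta>))
            * coeff_at (\<lambda>n. a n * of_nat n powr (-s)) (x / y * real m))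
       = p * of_real l powr (-s) * (\<Sum>m\<in>nats_upto y. b m * coeff_at a (l * real m) * of_nat m powr (-\<delta>))"
proof -
  have "(\<Sum>m\<in>nats_upto y. (b m * of_nat m powr (s - \<delta>))
            * coeff_at (\<lambda>n. a n * of_nat n powr (-s)) (x / y * real m))
      = (\<Sum>m\<in>nats_upto y. of_real l powr (-s) * (b m * coeff_at a (l * real m) * of_nat m powr (-\<delta>)))"
  proof (rule sum.cong[OF refl])
    fix m assume m: "m \<in> nats_upto y"
    then have pos: "l > 0" "m > 0" using assms by auto
    have "of_nat m powr (s - \<delta>) * of_nat m powr (-s) = (of_nat m powr (-\<delta>) :: complex)"
      using pos by (simp flip: powr_add)
    then show "(b m * of_nat m powr (s - \<delta>)) * coeff_at (\<lambda>n. a n * of_nat n powr (-s)) (x / y * real m)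
      = of_real l powr (-s) * (b m * coeff_at a (l * real m) * of_nat m powr (-\<delta>))"
      unfolding l[symmetric] coeff_at_powr[OF pos] by (simp add: mult_ac)
  qed
  then show ?thesis by (simp add: sum_distrib_left mult_ac)
qed

section \<open>Uniqueness of Dirichlet coefficients, for the zero function\<close>

lemma Dirichlet_coeffs_bounded:
  assumes "dirichlet_series_sums a (of_real c) z"
  obtains K where "K \<ge> 0" "\<And>n. norm (a (Suc n)) \<le> K * real (Suc n) powr c"
proof -
  from assms have "(\<lambda>n. a (Suc n) * of_nat (Suc n) powr (- of_real c)) \<longlonglongrightarrow> 0"
    unfolding dirichlet_series_sums_def by (intro summable_LIMSEQ_zero sums_summable)
  then have "Bseq (\<lambda>n. a (Suc n) * of_nat (Suc n) powr (- of_real c))"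
    by (intro convergent_imp_Bseq convergentI)
  then obtain K where K: "K > 0"
    "\<And>n. norm (a (Suc n) * of_nat (Suc n) powr (- of_real c)) \<le> K"
    by (elim BseqE) auto
  show ?thesis
  proof
    show "K \<ge> 0" using K by simp
    fix n
    have "norm (of_nat (Suc n) powr (- of_real c) :: complex) = real (Suc n) powr (-c)"
      using norm_powr_real_powr[of "of_nat (Suc n)" "- of_real c"] by simp
    with K(2)[of n] have "norm (a (Suc n)) * real (Suc n) powr (-c) \<le> K"
      by (simp add: norm_mult)
    then show "norm (a (Suc n)) \<le> K * real (Suc n) powr c"
      by (simp add: powr_minus field_simps)
  qed
qed

text \<open>Far to the right the first surviving term would dominate. If all earlier coefficients
  vanish, this term is minus the tail; comparing consecutive bases bounds its coefficient by a
  constant times \<open>q powr t\<close> with \<open>q < 1\<close>.\<close>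

lemma Dirichlet_coeffs_unique_zero:
  assumes zero: "\<And>s. Re s > c \<Longrightarrow> dirichlet_series_sums a s 0"
  shows "a (Suc N) = 0"
proof (induction N rule: less_induct)
  case (less N)
  \<comment> \<open>A real point of convergence, which makes the coefficients of size at most
    \<open>K * n powr k\<close>.\<close>
  define k where "k = c + 1"
  obtain K where K: "K \<ge> 0" "\<And>n. norm (a (Suc n)) \<le> K * real (Suc n) powr k"
    using Dirichlet_coeffs_bounded[OF zero[of "of_real k"]] by (auto simp: k_def)
  define M where "M = (\<Sum>n. K * real (Suc n) powr (-2))"
  have "summable (\<lambda>n. real n powr (-2))" by (simp add: summable_real_powr_iff)
  then have "summable (\<lambda>n. real (Suc n) powr (-2))" by (rule summable_Suc_iff[THEN iffD2])
  then have sm: "summable (\<lambda>n. K * real (Suc n) powr (-2))" by (rule summable_mult)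
  define q where "q = real (Suc N) / real (Suc (Suc N))"
  have q: "0 < q" "q < 1" by (auto simp: q_def)
  have bound: "norm (a (Suc N)) \<le> (real (Suc N) powr (k + 2) * M) * q powr t" if t: "t > 0" for t :: real
  proof -
    \<comment> \<open>The \<open>k\<close> absorbs the growth of the coefficients, the
      \<open>2\<close> makes the tail summable uniformly in \<open>t\<close>, and \<open>t\<close>
      stays free for the limit.\<close>
    define \<sigma> where "\<sigma> = k + 2 + t"
    define g where "g = (\<lambda>n. a (Suc n) * of_nat (Suc n) powr (- of_real \<sigma> :: complex))"
    have norm_g: "norm (g n) = norm (a (Suc n)) * real (Suc n) powr (-\<sigma>)" for n
      using norm_powr_real_powr[of "of_nat (Suc n)" "- of_real \<sigma>"] by (simp add: g_def norm_mult)
    have "g sums 0"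
      using zero[of "of_real \<sigma>"] t by (simp add: dirichlet_series_sums_def g_def \<sigma>_def k_def)
    then have "(\<lambda>n. g (n + Suc N)) sums (0 - sum g {..<Suc N})"
      using sums_split_initial_segment by blast
    \<comment> \<open>Index \<open>N\<close> carries the coefficient at \<open>Suc N\<close>; the
      induction hypothesis removes all smaller indices.\<close>
    moreover have "sum g {..<Suc N} = g N"
      using less.IH by (simp add: g_def)
    ultimately have tail: "(\<lambda>n. g (n + Suc N)) sums (- g N)" by simp
    have le: "norm (g (n + Suc N)) \<le> K * real (Suc (n + Suc N)) powr (-2) * real (Suc (Suc N)) powr (-t)" for n
    proof -
      let ?m = "real (Suc (n + Suc N))"
      have "norm (g (n + Suc N)) \<le> (K * ?m powr k) * ?m powr (-\<sigma>)"
        unfolding norm_g by (intro mult_right_mono K) auto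
      also have "\<dots> = K * (?m powr (-2) * ?m powr (-t))"
        by (simp add: \<sigma>_def mult.assoc flip: powr_add)
      also have "?m powr (-t) \<le> real (Suc (Suc N)) powr (-t)"
        using t by (intro powr_mono2') auto
      finally show ?thesis using K by (simp add: mult.assoc mult_left_mono)
    qed
    have sm': "summable (\<lambda>n. K * real (Suc (n + Suc N)) powr (-2))"
      using summable_ignore_initial_segment[OF sm, of "Suc N"] .
    have le_M: "(\<Sum>n. K * real (Suc (n + Suc N)) powr (-2)) \<le> M"
      using suminf_split_initial_segment[OF sm, of "Suc N"] K
      by (simp add: M_def sum_nonneg)
    have "norm (g N) = norm (\<Sum>n. g (n + Suc N))"
      using arg_cong[OF sums_unique[OF tail], of norm] by (simp only: norm_minus_cancel)
    also have "\<dots> \<le> (\<Sum>n. K * real (Suc (n + Suc N)) powr (-2) * real (Suc (Suc N)) powr (-t))"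
      by (rule norm_suminf_le[OF le summable_mult2[OF sm']])
    also have "\<dots> = (\<Sum>n. K * real (Suc (n + Suc N)) powr (-2)) * real (Suc (Suc N)) powr (-t)"
      by (rule suminf_mult2[OF sm', symmetric])
    also have "\<dots> \<le> M * real (Suc (Suc N)) powr (-t)"
      by (intro mult_right_mono le_M) auto
    finally have le': "norm (a (Suc N)) * real (Suc N) powr (-\<sigma>) \<le> M * real (Suc (Suc N)) powr (-t)"
      by (simp only: norm_g)
    have "real (Suc N) powr (-\<sigma>) * real (Suc N) powr \<sigma> = 1"
      by (simp flip: powr_add)
    then have "norm (a (Suc N)) = (norm (a (Suc N)) * real (Suc N) powr (-\<sigma>)) * real (Suc N) powr \<sigma>"
      by (simp only: mult.assoc mult_1_right)
    also have "\<dots> \<le> (M * real (Suc (Suc N)) powr (-t)) * real (Suc N) powr \<sigma>"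
      by (intro mult_right_mono le') simp
    also have "real (Suc N) powr \<sigma> = real (Suc N) powr (k + 2) * real (Suc N) powr t"
      by (simp only: \<sigma>_def powr_add)
    also have "(M * real (Suc (Suc N)) powr (-t)) * (real (Suc N) powr (k + 2) * real (Suc N) powr t)
        = (real (Suc N) powr (k + 2) * M) * (real (Suc N) powr t * real (Suc (Suc N)) powr (-t))"
      by (simp only: mult_ac)
    also have "real (Suc N) powr t * real (Suc (Suc N)) powr (-t) = q powr t"
      unfolding q_def by (subst powr_divide) (simp_all add: powr_minus divide_inverse)
    finally show ?thesis .
  qed
  \<comment> \<open>The left side of \<open>bound\<close> is independent of \<open>t\<close>, so
    letting \<open>t\<close> tend to infinity forces it to be 0.\<close>
  have "((\<lambda>t. (real (Suc N) powr (k + 2) * M) * q powr t) \<longlongrightarrow> (real (Suc N) powr (k + 2) * M) * 0) at_top"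
  proof (intro tendsto_mult tendsto_const)
    have "filterlim (\<lambda>t. ln q * t) at_bot at_top"
      using q by (intro filterlim_tendsto_neg_mult_at_bot[OF tendsto_const _ filterlim_ident]) simp
    from filterlim_compose[OF exp_at_bot this]
    show "((\<lambda>t. q powr t) \<longlongrightarrow> 0) at_top" using q by (simp add: powr_def mult.commute)
  qed
  then have "norm (a (Suc N)) \<le> (real (Suc N) powr (k + 2) * M) * 0"
    by (rule tendsto_lowerbound)
      (use eventually_mono[OF eventually_gt_at_top[of 0] bound] in simp_all)
  then show ?case by simp
qed

section \<open>Reflection of the remainders under the functional equation\<close>

text \<open>Using the functional equation at \<open>w\<close> and at \<open>\<delta> - w\<close>
  multiplies \<open>f w\<close> by \<open>\<psi> w * \<psi> (\<delta> - w)\<close>, so this product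
  is 1 wherever \<open>f w\<close> is nonzero. The identity theorem on the connected set
  \<open>D\<close> handles a zero at \<open>s\<close>.\<close>

lemma self_dual_cases:
  assumes ds: "given_by_dirichlet_series f a"
    and sd: "self_dual_on R \<delta> f a b \<psi> T"
    and fe: "\<forall>w\<in>R. \<delta> - w \<in> R \<longrightarrow> f w = \<psi> w * f (\<delta> - w)"
    and s: "s \<in> R" "\<delta> - s \<in> R"
  shows "\<psi> s * \<psi> (\<delta> - s) = 1 \<or> (\<forall>n>0. a n = 0)"
proof -
  from sd have R: "open R" "continuous_on R \<psi>" and "continued_analytically_to f R"
    by (auto simp: self_dual_on_def)
  then obtain D c where D: "open D" "connected D" "{s. Re s > c} \<subseteq> D" "R \<subseteq> D" "f holomorphic_on D"
    by (auto simp: continued_analytically_to_def)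
  have one: "\<psi> w * \<psi> (\<delta> - w) = 1" if "w \<in> R" "\<delta> - w \<in> R" "f w \<noteq> 0" for w
  proof -
    have "f w = \<psi> w * f (\<delta> - w)" using fe that by blast
    moreover have "f (\<delta> - w) = \<psi> (\<delta> - w) * f w" using fe[rule_format, of "\<delta> - w"] that by simp
    ultimately have "f w * (\<psi> w * \<psi> (\<delta> - w)) = f w * 1" by (metis mult.assoc mult.commute mult.right_neutral)
    then show ?thesis using that by simp
  qed
  show ?thesis
  proof (cases "\<exists>\<beta>\<in>D. f \<beta> \<noteq> 0")
    case False
    \<comment> \<open>\<open>D\<close> contains a right half plane, where \<open>f\<close> is also
      the sum of its series once the real part exceeds both abscissae.\<close>
    from ds obtain c' where c': "\<And>s. Re s > c' \<Longrightarrow> dirichlet_series_sums a s (f s)"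
      by (auto simp: given_by_dirichlet_series_def)
    have "dirichlet_series_sums a w 0" if "Re w > max c c'" for w
      using c'[of w] that False D(3) by auto
    from Dirichlet_coeffs_unique_zero[OF this] have "\<forall>n>0. a n = 0" by (metis gr0_conv_Suc)
    then show ?thesis ..
  next
    case True
    then obtain \<beta> where \<beta>: "\<beta> \<in> D" "f \<beta> \<noteq> 0" by blast
    have "\<psi> s * \<psi> (\<delta> - s) = 1"
    proof (cases "f s = 0")
      case False
      then show ?thesis using one s by blast
    next
      case True
      obtain r where r: "r > 0" "\<And>z. z \<in> ball s r - {s} \<Longrightarrow> f z \<noteq> 0"
        using isolated_zeros[OF D(5) D(1) D(2) subsetD[OF D(4) s(1)] True \<beta>] by metis
      \<comment> \<open>Continuity carries the value 1 to the zero \<open>s\<close> from a punctured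
        neighbourhood on which \<open>f\<close> is nonzero and both \<open>w\<close> and
        \<open>\<delta> - w\<close> lie in \<open>R\<close>.\<close>
      have lim: "((\<lambda>w. \<psi> w * \<psi> (\<delta> - w)) \<longlongrightarrow> \<psi> s * \<psi> (\<delta> - s)) (at s)"
      proof -
        have "isCont \<psi> s" "isCont \<psi> (\<delta> - s)"
          using R s by (auto simp: continuous_on_eq_continuous_at)
        then have "isCont (\<lambda>w. \<psi> w * \<psi> (\<delta> - w)) s"
          by (intro continuous_intros isCont_o2[where g = \<psi> and f = "\<lambda>w. \<delta> - w"]) auto
        then show ?thesis by (simp add: isCont_def)
      qed
      have "\<forall>\<^sub>F w in at s. w \<in> R"
        using R(1) s(1) by (rule eventually_at_in_open')
      moreover have "\<forall>\<^sub>F w in at s. w \<in> (\<lambda>w. \<delta> - w) -` R"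
        using R(1) s(2) by (intro eventually_at_in_open' open_vimage continuous_intros) auto
      moreover have "\<forall>\<^sub>F w in at s. w \<in> ball s r - {s}"
        using r(1) by (intro eventually_at_in_open) auto
      ultimately have "\<forall>\<^sub>F w in at s. \<psi> w * \<psi> (\<delta> - w) = 1"
        by eventually_elim (use one r in auto)
      then have "((\<lambda>w. \<psi> w * \<psi> (\<delta> - w)) \<longlongrightarrow> 1) (at s)"
        by (rule tendsto_eventually)
      from tendsto_unique[OF _ lim this] show ?thesis by simp
    qed
    then show ?thesis ..
  qed
qed

text \<open>Subtract \<psi>(s) times the relation at \<open>\<delta> - s\<close> with argument
  \<open>T s / x\<close> from the relation at \<open>s\<close>. Self-duality makes the two finite
  sums change places, since \<open>T s / (T s / x) = x\<close>, and everything but the remainders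
  cancels. Positivity of \<open>T s\<close> makes the reflected argument admissible.\<close>

lemma remainder_reflect:
  assumes ds: "given_by_dirichlet_series f a"
    and sd: "self_dual_on R \<delta> f a b \<psi> T"
    and fe: "\<forall>w\<in>R. \<delta> - w \<in> R \<longrightarrow> f w = \<psi> w * f (\<delta> - w)"
    and rel: "\<forall>w\<in>R. \<forall>x>0. f w = psum a (-w) x + \<psi> w * psum b (w - \<delta>) (T w / x) + E w x"
    and s: "s \<in> R" "\<delta> - s \<in> R" and "x > 0" "T s > 0"
  shows "E s x = \<psi> s * E (\<delta> - s) (T s / x)"
proof -
  have T: "T (\<delta> - s) = T s" and ba: "\<And>n. n > 0 \<Longrightarrow> b n = a n"
    using sd s by (auto simp: self_dual_on_def)
  have b: "psum b w y = psum a w y" for w y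
    unfolding psum_def by (intro sum.cong) (auto simp: ba)
  have 1: "f s = psum a (-s) x + \<psi> s * psum a (s - \<delta>) (T s / x) + E s x"
    using rel s \<open>x > 0\<close> b by auto
  have "f (\<delta> - s) = psum a (-(\<delta> - s)) (T s / x)
      + \<psi> (\<delta> - s) * psum b (\<delta> - s - \<delta>) (T (\<delta> - s) / (T s / x)) + E (\<delta> - s) (T s / x)"
    using rel s assms(7,8) by (metis divide_pos_pos)
  then have 2: "f (\<delta> - s) = psum a (s - \<delta>) (T s / x)
      + \<psi> (\<delta> - s) * psum a (-s) x + E (\<delta> - s) (T s / x)"
    using assms(7,8) by (simp add: T b)
  \<comment> \<open>In the exceptional case of vanishing coefficients the finite sum itself is
    0.\<close>
  have 3: "\<psi> s * \<psi> (\<delta> - s) * psum a (-s) x = psum a (-s) x"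
  proof -
    have "psum a (-s) x = 0" if "\<forall>n>0. a n = 0"
      unfolding psum_def using that by (intro sum.neutral) auto
    then show ?thesis using self_dual_cases[OF ds sd fe s] by auto
  qed
  have 4: "f s = \<psi> s * f (\<delta> - s)" using fe s by blast
  have "E s x = \<psi> s * f (\<delta> - s) - psum a (-s) x - \<psi> s * psum a (s - \<delta>) (T s / x)"
    using 1 unfolding 4[symmetric] by simp
  also have "\<psi> s * f (\<delta> - s) = \<psi> s * psum a (s - \<delta>) (T s / x)
      + \<psi> s * \<psi> (\<delta> - s) * psum a (-s) x + \<psi> s * E (\<delta> - s) (T s / x)"
    by (simp add: 2 algebra_simps)
  finally show ?thesis unfolding 3 by simp
qed

text \<open>Reflects every remainder in \<open>I3\<close> or \<open>I4\<close>. Condition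
  \<open>dom\<close> excludes a nonempty sum with \<open>T s = 0\<close>: there the reflected
  argument would be 0, where the relation says nothing about the remainder.\<close>

lemma reflected_sum:
  assumes "given_by_dirichlet_series f a"
    and "self_dual_on R \<delta> f a b \<psi> T"
    and "\<forall>w\<in>R. \<delta> - w \<in> R \<longrightarrow> f w = \<psi> w * f (\<delta> - w)"
    and "\<forall>w\<in>R. \<forall>x>0. f w = psum a (-w) x + \<psi> w * psum b (w - \<delta>) (T w / x) + E w x"
    and "s \<in> R" "\<delta> - s \<in> R" and "x > 0" and y: "y = T s / x"
    and dom: "Y < 1 \<or> y > 0"
  shows "(\<Sum>m\<in>nats_upto Y. g m * E s (real m * x / Y))
       = \<psi> s * (\<Sum>m\<in>nats_upto Y. g m * E (\<delta> - s) (Y * y / real m))"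
proof (cases "Y < 1")
  case True
  then show ?thesis by (simp add: nats_upto_empty)
next
  case False
  then have pos: "Y > 0" "T s > 0" using dom y \<open>x > 0\<close> by (auto simp: zero_less_divide_iff)
  have "E s (real m * x / Y) = \<psi> s * E (\<delta> - s) (Y * y / real m)" if "m > 0" for m
  proof -
    have "T s / (real m * x / Y) = Y * y / real m"
      using that pos \<open>x > 0\<close> y by (simp add: field_simps)
    then show ?thesis
      using remainder_reflect[OF assms(1-6), of "real m * x / Y"] that pos \<open>x > 0\<close> by simp
  qed
  then show ?thesis by (auto simp: sum_distrib_left mult_ac intro!: sum.cong)
qed

section \<open>The product formula and the reflected forms of \<open>I3\<close> and
  \<open>I4\<close>\<close>

theorem theorem1:
  fixes f1 f2 \<psi>1 \<psi>2 :: "complex \<Rightarrow> complex"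
    and a1 a2 b1 b2 :: "nat \<Rightarrow> complex"
    and \<delta> s :: complex
    and R :: "complex set"
    and T1 T2 :: "complex \<Rightarrow> real"
    and E1 E2 :: "complex \<Rightarrow> real \<Rightarrow> complex"
    and x1 x2 y1 y2 l1 l2 :: real
    and A B :: "nat \<Rightarrow> complex"
    and E12 I1 I2 I3 I4 I5 L1 L2 :: complex
  assumes "given_by_dirichlet_series f1 a1" and "given_by_dirichlet_series f2 a2"
    and "dirichlet_series_converges b1" and "dirichlet_series_converges b2"
    and "\<forall>w\<in>R. T1 w \<ge> 0" and "\<forall>w\<in>R. T2 w \<ge> 0"
    and rel1: "\<forall>w\<in>R. \<forall>x>0.
           f1 w = psum a1 (-w) x + \<psi>1 w * psum b1 (w - \<delta>) (T1 w / x) + E1 w x"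
    and rel2: "\<forall>w\<in>R. \<forall>x>0.
           f2 w = psum a2 (-w) x + \<psi>2 w * psum b2 (w - \<delta>) (T2 w / x) + E2 w x"
    and "s \<in> R" and "x1 > 0" and "x2 > 0"
    and "y1 = T1 s / x1" and "y2 = T2 s / x2"
    and "l1 = x1 / y2" and "l2 = x2 / y1"
    and "A = dconv a1 a2" and "B = dconv b1 b2"
    and "I1 = (\<Sum>n | 0 < n \<and> real n \<le> x1. a1 n * of_nat n powr (-s) * E2 s (x1 * x2 / real n))"
    and "I2 = (\<Sum>n | 0 < n \<and> real n \<le> x2. a2 n * of_nat n powr (-s) * E1 s (x1 * x2 / real n))"
    and "I3 = \<psi>1 s * (\<Sum>m | 0 < m \<and> real m \<le> y1.
                 b1 m * of_nat m powr (s - \<delta>) * E2 s (real m * x2 / y1))"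
    and "I4 = \<psi>2 s * (\<Sum>m | 0 < m \<and> real m \<le> y2.
                 b2 m * of_nat m powr (s - \<delta>) * E1 s (real m * x1 / y2))"
    and "I5 = E1 s x1 * E2 s x2"
    and "L1 = \<psi>1 s * of_real l2 powr (-s) * (\<Sum>m | 0 < m \<and> real m \<le> y1.
                 b1 m * coeff_at a2 (l2 * real m) * of_nat m powr (-\<delta>))"
    and "L2 = \<psi>2 s * of_real l1 powr (-s) * (\<Sum>n | 0 < n \<and> real n \<le> y2.
                 b2 n * coeff_at a1 (l1 * real n) * of_nat n powr (-\<delta>))"
    and "E12 = I1 + I2 + I3 + I4 + I5 + L1 + L2"
  shows "f1 s * f2 s =
           psum A (-s) (x1 * x2) + \<psi>1 s * \<psi>2 s * psum B (s - \<delta>) (y1 * y2) + E12 \<and>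
         (\<delta> - s \<in> R \<longrightarrow>
          (\<forall>w\<in>R. \<delta> - w \<in> R \<longrightarrow> f1 w = \<psi>1 w * f1 (\<delta> - w)) \<longrightarrow>
          self_dual_on R \<delta> f1 a1 b1 \<psi>1 T1 \<longrightarrow>
          (\<forall>w\<in>R. \<delta> - w \<in> R \<longrightarrow> f2 w = \<psi>2 w * f2 (\<delta> - w)) \<longrightarrow>
          self_dual_on R \<delta> f2 a2 b2 \<psi>2 T2 \<longrightarrow>
            (y1 < 1 \<or> y2 > 0 \<longrightarrow>
              I3 = \<psi>1 s * \<psi>2 s * (\<Sum>n | 0 < n \<and> real n \<le> y1.
                     b1 n * of_nat n powr (s - \<delta>) * E2 (\<delta> - s) (y1 * y2 / real n))) \<and>
            (y2 < 1 \<or> y1 > 0 \<longrightarrow>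
              I4 = \<psi>1 s * \<psi>2 s * (\<Sum>n | 0 < n \<and> real n \<le> y2.
                     b2 n * of_nat n powr (s - \<delta>) * E1 (\<delta> - s) (y1 * y2 / real n))))"
proof (intro conjI impI)
  note x = \<open>x1 > 0\<close> \<open>x2 > 0\<close>
  note defs = \<open>A = _\<close> \<open>B = _\<close> \<open>E12 = _\<close> \<open>I1 = _\<close> \<open>I2 = _\<close> \<open>I3 = _\<close> \<open>I4 = _\<close> \<open>I5 = _\<close>
    \<open>L1 = _\<close> \<open>L2 = _\<close>
  have T: "T1 s \<ge> 0" "T2 s \<ge> 0" using assms by auto
  show "f1 s * f2 s =
      psum A (-s) (x1 * x2) + \<psi>1 s * \<psi>2 s * psum B (s - \<delta>) (y1 * y2) + E12"
    \<comment> \<open>Read backwards, \<open>diagonal_sum_powr\<close> restores the absorbed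
      coefficients \<open>a n * of_nat n powr (-s)\<close> and
      \<open>b n * of_nat n powr (s - \<delta>)\<close> that \<open>approximate_product\<close>
      expects.\<close>
    unfolding defs psum_dconv
      diagonal_sum_powr[OF x(2) \<open>l2 = _\<close>, symmetric] diagonal_sum_powr[OF x(1) \<open>l1 = _\<close>, symmetric]
    by (rule approximate_product[OF _ _ x T \<open>y1 = _\<close> \<open>y2 = _\<close>])
      (use rel1 rel2 \<open>s \<in> R\<close> in \<open>auto simp: psum_def\<close>)
next
  assume *: "\<delta> - s \<in> R"
    "\<forall>w\<in>R. \<delta> - w \<in> R \<longrightarrow> f2 w = \<psi>2 w * f2 (\<delta> - w)" "self_dual_on R \<delta> f2 a2 b2 \<psi>2 T2"
    "y1 < 1 \<or> y2 > 0"
  \<comment> \<open>Only \<open>E2\<close> is reflected, so the functional equation of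
    \<open>f2\<close> suffices; \<open>reflected_sum\<close> is taken with \<open>Y = y1\<close>,
    \<open>x = x2\<close>, \<open>y = y2\<close>. The case of \<open>I4\<close> is
    symmetric.\<close>
  show "I3 = \<psi>1 s * \<psi>2 s * (\<Sum>n | 0 < n \<and> real n \<le> y1.
          b1 n * of_nat n powr (s - \<delta>) * E2 (\<delta> - s) (y1 * y2 / real n))"
    unfolding \<open>I3 = _\<close>
      reflected_sum[OF \<open>given_by_dirichlet_series f2 a2\<close> *(3,2) rel2 \<open>s \<in> R\<close> *(1) \<open>x2 > 0\<close> \<open>y2 = _\<close> *(4)]
    by (simp add: mult_ac)
next
  assume *: "\<delta> - s \<in> R"
    "\<forall>w\<in>R. \<delta> - w \<in> R \<longrightarrow> f1 w = \<psi>1 w * f1 (\<delta> - w)" "self_dual_on R \<delta> f1 a1 b1 \<psi>1 T1"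
    "y2 < 1 \<or> y1 > 0"
  show "I4 = \<psi>1 s * \<psi>2 s * (\<Sum>n | 0 < n \<and> real n \<le> y2.
          b2 n * of_nat n powr (s - \<delta>) * E1 (\<delta> - s) (y1 * y2 / real n))"
    unfolding \<open>I4 = _\<close>
      reflected_sum[OF \<open>given_by_dirichlet_series f1 a1\<close> *(3,2) rel1 \<open>s \<in> R\<close> *(1) \<open>x1 > 0\<close> \<open>y1 = _\<close> *(4)]
    by (simp add: mult_ac)
qed

end
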